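(* The group $$H_4=\langle x_1,x_2,x_3,x_4 \mid x_1x_2x_3=x_4,\; x_2x_3x_4=x_1,\; x_3x_4x_1=x_2,\; x_4x_1x_2=x_3\rangle$$ does not satisfy the unique product property.
   Context: A group $G$ has the unique product property if for all non-empty finite subsets $A,B\subseteq G$ there exist some $a\in A$ and $b\in B$ such that whenever $ab=a'b'$ with $a'\in A$ and $b'\in B$, then $a=a'$ and $b=b'$. (Equivalently, in the multiset $AB$ of all products $ab$ with $a\in A$, $b\in B$, some element occurs with multiplicity $1$.) *)

theory Defs
  imports "HOL-Algebra.Generated_Groups"
begin

section \<open>Free groups\<close>

text \<open>A letter \<open>(x, True)\<close> stands for the generator \<open>x\<close> and \<open>(x, False)\<close> for its formal inverse.\<close>

type_synonym 'a word = "('a \<times> bool) list"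

definition words :: "'a set \<Rightarrow> 'a word set" where
  "words X = lists (X \<times> UNIV)"

inductive_set free_rel :: "'a set \<Rightarrow> ('a word \<times> 'a word) set" for X :: "'a set" where
  cancel: "u \<in> words X \<Longrightarrow> v \<in> words X \<Longrightarrow> x \<in> X \<Longrightarrow>
             (u @ [(x, b), (x, \<not> b)] @ v, u @ v) \<in> free_rel X"
| refl: "w \<in> words X \<Longrightarrow> (w, w) \<in> free_rel X"
| sym: "(u, v) \<in> free_rel X \<Longrightarrow> (v, u) \<in> free_rel X"
| trans: "(u, v) \<in> free_rel X \<Longrightarrow> (v, w) \<in> free_rel X \<Longrightarrow> (u, w) \<in> free_rel X"

definition word_class :: "'a set \<Rightarrow> 'a word \<Rightarrow> 'a word set" where
  "word_class X w = free_rel X `` {w}"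

definition free_group :: "'a set \<Rightarrow> 'a word set monoid" where
  "free_group X =
     \<lparr>carrier = words X // free_rel X,
      mult = (\<lambda>S T. \<Union>u\<in>S. \<Union>v\<in>T. word_class X (u @ v)),
      one = word_class X []\<rparr>"

section \<open>Group presentations\<close>

definition normal_closure :: "('a, 'b) monoid_scheme \<Rightarrow> 'a set \<Rightarrow> 'a set" where
  "normal_closure G S = \<Inter>{N. N \<lhd> G \<and> S \<subseteq> N}"

text \<open>A pair \<open>(u, v)\<close> in \<open>R\<close> is the relation \<open>u = v\<close>, that is, the relator \<open>u v\<inverse>\<close>.
  The definition is meant for \<open>R \<subseteq> words X \<times> words X\<close>.\<close>

definition relators :: "'a set \<Rightarrow> ('a word \<times> 'a word) set \<Rightarrow> 'a word set set" where
  "relators X R =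
     (\<lambda>(u, v). word_class X u \<otimes>\<^bsub>free_group X\<^esub> inv\<^bsub>free_group X\<^esub> (word_class X v)) ` R"

definition presented_group ::
    "'a set \<Rightarrow> ('a word \<times> 'a word) set \<Rightarrow> 'a word set set monoid" where
  "presented_group X R = free_group X Mod normal_closure (free_group X) (relators X R)"

section \<open>The group \<open>H\<^sub>4\<close>\<close>

definition H4_relations :: "(nat word \<times> nat word) set" where
  "H4_relations =
     (let x = (\<lambda>i. (i, True)) in
       {([x 1, x 2, x 3], [x 4]),
        ([x 2, x 3, x 4], [x 1]),
        ([x 3, x 4, x 1], [x 2]),
        ([x 4, x 1, x 2], [x 3])})"

definition H4 :: "nat word set set monoid" where
  "H4 = presented_group {1, 2, 3, 4} H4_relations"

section \<open>The unique product property\<close>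

definition unique_product_property :: "('a, 'b) monoid_scheme \<Rightarrow> bool" where
  "unique_product_property G \<longleftrightarrow>
     (\<forall>A B. finite A \<and> A \<noteq> {} \<and> A \<subseteq> carrier G \<and> finite B \<and> B \<noteq> {} \<and> B \<subseteq> carrier G \<longrightarrow>
       (\<exists>a\<in>A. \<exists>b\<in>B. \<forall>a'\<in>A. \<forall>b'\<in>B.
          a \<otimes>\<^bsub>G\<^esub> b = a' \<otimes>\<^bsub>G\<^esub> b' \<longrightarrow> a = a' \<and> b = b'))"

section \<open>Well-definedness\<close>

lemma words_simps [simp]:
  "[] \<in> words X"
  "p # w \<in> words X \<longleftrightarrow> fst p \<in> X \<and> w \<in> words X"
  "u @ v \<in> words X \<longleftrightarrow> u \<in> words X \<and> v \<in> words X"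
  by (auto simp: words_def mem_Times_iff)

lemma free_rel_words: "(u, v) \<in> free_rel X \<Longrightarrow> u \<in> words X \<and> v \<in> words X"
  by (induction rule: free_rel.induct) auto

lemma equiv_free_rel: "equiv (words X) (free_rel X)"
proof (rule equivI)
  show "free_rel X \<subseteq> words X \<times> words X"
    using free_rel_words by auto
  show "refl_on (words X) (free_rel X)"
    by (auto simp: refl_on_def intro: free_rel.refl)
  show "Relation.sym (free_rel X)"
    by (auto simp: Relation.sym_def intro: free_rel.sym)
  show "Relation.trans (free_rel X)"
    unfolding Relation.trans_def by (blast intro: free_rel.trans)
qed

lemma free_rel_append_left:
  "(u, v) \<in> free_rel X \<Longrightarrow> w \<in> words X \<Longrightarrow> (w @ u, w @ v) \<in> free_rel X"
proof (induction rule: free_rel.induct)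
  case (cancel u v x b)
  then show ?case using free_rel.cancel[of "w @ u" X v x b] by simp
next
  case (refl u) then show ?case by (simp add: free_rel.refl)
next
  case (sym u v) then show ?case by (meson free_rel.sym)
next
  case (trans u v z) then show ?case by (meson free_rel.trans)
qed

lemma free_rel_append_right:
  "(u, v) \<in> free_rel X \<Longrightarrow> w \<in> words X \<Longrightarrow> (u @ w, v @ w) \<in> free_rel X"
proof (induction rule: free_rel.induct)
  case (cancel u v x b)
  then show ?case using free_rel.cancel[of u X "v @ w" x b] by simp
next
  case (refl u) then show ?case by (simp add: free_rel.refl)
next
  case (sym u v) then show ?case by (meson free_rel.sym)
next
  case (trans u v z) then show ?case by (meson free_rel.trans)
qed

lemma free_rel_append:
  assumes "(u, u') \<in> free_rel X" and "(v, v') \<in> free_rel X"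
  shows "(u @ v, u' @ v') \<in> free_rel X"
proof -
  have "(u @ v, u' @ v) \<in> free_rel X"
    using assms free_rel_words free_rel_append_right by blast
  moreover have "(u' @ v, u' @ v') \<in> free_rel X"
    using assms free_rel_words free_rel_append_left by blast
  ultimately show ?thesis by (rule free_rel.trans)
qed

lemma word_class_eq_iff:
  "u \<in> words X \<Longrightarrow> v \<in> words X \<Longrightarrow> word_class X u = word_class X v \<longleftrightarrow> (u, v) \<in> free_rel X"
  unfolding word_class_def by (rule eq_equiv_class_iff[OF equiv_free_rel])

lemma carrier_free_group: "carrier (free_group X) = word_class X ` words X"
  by (auto simp: free_group_def quotient_def word_class_def)

lemma one_free_group: "\<one>\<^bsub>free_group X\<^esub> = word_class X []"
  by (simp add: free_group_def)

lemma mult_free_group: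
  assumes "u \<in> words X" and "v \<in> words X"
  shows "word_class X u \<otimes>\<^bsub>free_group X\<^esub> word_class X v = word_class X (u @ v)"
proof -
  have eq: "word_class X (u' @ v') = word_class X (u @ v)"
    if "u' \<in> word_class X u" "v' \<in> word_class X v" for u' v'
  proof -
    have "(u @ v, u' @ v') \<in> free_rel X"
      using that by (auto simp: word_class_def intro: free_rel_append)
    then show ?thesis
      using free_rel_words free_rel.sym word_class_eq_iff by blast
  qed
  have "u \<in> word_class X u" "v \<in> word_class X v"
    using assms by (auto simp: word_class_def intro: free_rel.refl)
  then have "(\<Union>u'\<in>word_class X u. \<Union>v'\<in>word_class X v. word_class X (u' @ v'))
      = word_class X (u @ v)"
    using eq by blast
  then show ?thesis by (simp add: free_group_def)
qed

definition inverse_word :: "'a word \<Rightarrow> 'a word" where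
  "inverse_word w = rev (map (\<lambda>(x, b). (x, \<not> b)) w)"

lemma inverse_word_words [simp]: "w \<in> words X \<Longrightarrow> inverse_word w \<in> words X"
  by (induction w) (auto simp: inverse_word_def)

lemma inverse_word_cancel:
  "w \<in> words X \<Longrightarrow> (inverse_word w @ w, []) \<in> free_rel X"
proof (induction w)
  case Nil
  then show ?case by (simp add: inverse_word_def free_rel.refl)
next
  case (Cons p w)
  obtain x b where p: "p = (x, b)" by force
  have inv: "inverse_word ((x, b) # w) = inverse_word w @ [(x, \<not> b)]"
    by (simp add: inverse_word_def p)
  have "(inverse_word w @ [(x, \<not> b), (x, \<not> \<not> b)] @ w, inverse_word w @ w) \<in> free_rel X"
    by (rule free_rel.cancel) (use Cons.prems p in auto)
  then have "(inverse_word (p # w) @ p # w, inverse_word w @ w) \<in> free_rel X"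
    unfolding p inv by simp
  moreover have "(inverse_word w @ w, []) \<in> free_rel X"
    using Cons by simp
  ultimately show ?case by (rule free_rel.trans)
qed

lemma group_free_group: "group (free_group X)"
proof (rule groupI)
  fix S T U
  assume S: "S \<in> carrier (free_group X)" and T: "T \<in> carrier (free_group X)"
  then show "S \<otimes>\<^bsub>free_group X\<^esub> T \<in> carrier (free_group X)"
    by (auto simp: carrier_free_group mult_free_group)
  assume "U \<in> carrier (free_group X)"
  with S T show "S \<otimes>\<^bsub>free_group X\<^esub> T \<otimes>\<^bsub>free_group X\<^esub> U
      = S \<otimes>\<^bsub>free_group X\<^esub> (T \<otimes>\<^bsub>free_group X\<^esub> U)"
    by (auto simp: carrier_free_group mult_free_group)
next
  show "\<one>\<^bsub>free_group X\<^esub> \<in> carrier (free_group X)"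
    by (auto simp: carrier_free_group one_free_group)
next
  fix S assume "S \<in> carrier (free_group X)"
  then obtain w where w: "w \<in> words X" "S = word_class X w"
    by (auto simp: carrier_free_group)
  show "\<one>\<^bsub>free_group X\<^esub> \<otimes>\<^bsub>free_group X\<^esub> S = S"
    using w by (simp add: one_free_group mult_free_group)
  have "word_class X (inverse_word w) \<otimes>\<^bsub>free_group X\<^esub> S = \<one>\<^bsub>free_group X\<^esub>"
    using w by (simp add: one_free_group mult_free_group word_class_eq_iff inverse_word_cancel)
  then show "\<exists>T\<in>carrier (free_group X). T \<otimes>\<^bsub>free_group X\<^esub> S = \<one>\<^bsub>free_group X\<^esub>"
    using w by (auto simp: carrier_free_group)
qed

lemma (in group) normal_closure_normal:
  assumes "S \<subseteq> carrier G"
  shows "normal_closure G S \<lhd> G"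
proof -
  have ne: "{N. N \<lhd> G \<and> S \<subseteq> N} \<noteq> {}"
    using assms normal_self by blast
  have "subgroup (normal_closure G S) G"
    unfolding normal_closure_def
    by (rule subgroups_Inter) (use ne in \<open>auto simp: normal_imp_subgroup\<close>)
  moreover have "x \<otimes> h \<otimes> inv x \<in> normal_closure G S"
    if "x \<in> carrier G" "h \<in> normal_closure G S" for x h
    using that unfolding normal_closure_def by (blast intro: normal.inv_op_closed2)
  ultimately show ?thesis by (simp add: normal_inv_iff)
qed

lemma relators_closed:
  assumes "R \<subseteq> words X \<times> words X"
  shows "relators X R \<subseteq> carrier (free_group X)"
proof -
  interpret F: group "free_group X" by (rule group_free_group)
  have "word_class X u \<in> carrier (free_group X)" if "u \<in> words X" for u
    using that by (simp add: carrier_free_group)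
  then show ?thesis
    using assms by (auto simp: relators_def)
qed

lemma group_presented_group:
  assumes "R \<subseteq> words X \<times> words X"
  shows "group (presented_group X R)"
  unfolding presented_group_def
  by (rule normal.factorgroup_is_group[OF
        group.normal_closure_normal[OF group_free_group relators_closed[OF assms]]])

lemma group_H4: "group H4"
  unfolding H4_def by (rule group_presented_group) (auto simp: H4_relations_def Let_def)

end

theory Submission
  imports Defs
begin

text \<open>
  Regrouping \<open>x\<^sub>1 x\<^sub>2 x\<^sub>3 x\<^sub>4\<close> and its cyclic rotations shows that all four generators of
  \<open>H\<^sub>4\<close> have the same square, which is therefore central. Put \<open>x = x\<^sub>1\<close>, \<open>a = x\<^sub>2 x\<inverse>\<close> and \<open>b = x\<^sub>4 x\<inverse>\<close>.
  Conjugation by \<open>x\<close> inverts \<open>a\<close> and \<open>b\<close>, and \<open>b a = a b x\<^sup>-\<^sup>4\<close>. So every element can be written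
  \<open>a\<^sup>i b\<^sup>j x\<^sup>n\<close>, and these expressions multiply by an explicit law on integer triples: \<open>H\<^sub>4\<close> is a
  central extension of \<open>\<int>\<^sup>2 \<rtimes> {1, -1}\<close> by the infinite cyclic group generated by \<open>x\<^sup>2\<close>. Let
  \<open>nil_group\<close> be the group of triples. Evaluating normal forms is a homomorphism from it to \<open>H\<^sub>4\<close>
  (\<open>normal_form_hom\<close>). It is injective because the universal property of the presentation gives a
  homomorphism back which is a left inverse (\<open>nil_group_embeds_in_H4\<close>). As the unique product
  property passes to subgroups, it is enough to refute it for triples.

  The counterexample has the shape \<open>A = T \<union> T x\<close> and \<open>B = L \<union> x L\<close>. The identity
  \<open>t (x l) = (t x) l\<close> shows that half of the products occur at least twice, whatever \<open>T\<close> and \<open>L\<close>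
  are. Only the products \<open>t l\<close> and \<open>t x\<^sup>2 l\<close> have to be matched with others
  (\<open>doubled_sets_without_unique_product\<close>), and for suitable \<open>T\<close> with five and \<open>L\<close> with eleven
  elements this is a finite calculation with triples.
\<close>

section \<open>Maps into and out of a presented group\<close>

fun eval_word :: "('g, 'm) monoid_scheme \<Rightarrow> ('a \<Rightarrow> 'g) \<Rightarrow> 'a word \<Rightarrow> 'g" where
  "eval_word K f [] = \<one>\<^bsub>K\<^esub>"
| "eval_word K f ((x, b) # w) = (if b then f x else inv\<^bsub>K\<^esub> f x) \<otimes>\<^bsub>K\<^esub> eval_word K f w"

context group
begin

lemma eval_word_closed [simp]:
  "f \<in> X \<rightarrow> carrier G \<Longrightarrow> w \<in> words X \<Longrightarrow> eval_word G f w \<in> carrier G"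
  by (induction w) (auto simp: Pi_iff)

lemma eval_word_append:
  "f \<in> X \<rightarrow> carrier G \<Longrightarrow> u \<in> words X \<Longrightarrow> v \<in> words X
    \<Longrightarrow> eval_word G f (u @ v) = eval_word G f u \<otimes> eval_word G f v"
proof (induction u)
  case (Cons p u)
  then show ?case by (cases p) (auto simp: m_assoc Pi_iff)
qed simp

lemma eval_word_free_rel:
  assumes "f \<in> X \<rightarrow> carrier G" and "(u, v) \<in> free_rel X"
  shows "eval_word G f u = eval_word G f v"
  using assms(2)
proof induction
  case (cancel u v x b)
  then have "f x \<in> carrier G" using assms(1) by auto
  then have "eval_word G f ((x, b) # (x, \<not> b) # v) = eval_word G f v"
    using cancel assms(1) by (cases b) (simp_all add: m_assoc[symmetric])
  then show ?case
    using cancel assms(1) by (simp add: eval_word_append)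
qed auto

text \<open>The map is defined through a chosen representative of each class, which is harmless because
  cancelling adjacent inverse letters does not change the value of a word.\<close>

lemma free_group_universal:
  assumes f: "f \<in> X \<rightarrow> carrier G"
  obtains h where "h \<in> hom (free_group X) G"
    and "\<And>w. w \<in> words X \<Longrightarrow> h (word_class X w) = eval_word G f w"
proof -
  define h where "h C = eval_word G f (SOME w. w \<in> C)" for C
  have h: "h (word_class X w) = eval_word G f w" if w: "w \<in> words X" for w
  proof -
    have "w \<in> word_class X w"
      using w by (simp add: word_class_def free_rel.refl)
    then have "(SOME v. v \<in> word_class X w) \<in> word_class X w"
      by (rule someI)
    then show ?thesis
      using eval_word_free_rel[OF f] by (simp add: h_def word_class_def)
  qed
  have "h \<in> hom (free_group X) G"
    using f by (auto simp: hom_def carrier_free_group mult_free_group h eval_word_append)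
  with h show thesis by (rule that[rotated])
qed

end

definition generator :: "'a set \<Rightarrow> ('a word \<times> 'a word) set \<Rightarrow> 'a \<Rightarrow> 'a word set set" where
  "generator X R x =
     normal_closure (free_group X) (relators X R) #>\<^bsub>free_group X\<^esub> word_class X [(x, True)]"

text \<open>von Dyck's theorem: the kernel of the map out of the free group is normal and contains the
  relators, hence contains their normal closure.\<close>

theorem (in group) presented_group_universal:
  assumes R: "R \<subseteq> words X \<times> words X" and f: "f \<in> X \<rightarrow> carrier G"
    and rel: "\<And>u v. (u, v) \<in> R \<Longrightarrow> eval_word G f u = eval_word G f v"
  obtains h where "h \<in> hom (presented_group X R) G"
    and "\<And>x. x \<in> X \<Longrightarrow> h (generator X R x) = f x"
proof -
  define F where "F = free_group X"
  interpret F: group F unfolding F_def by (rule group_free_group)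
  obtain g where g: "g \<in> hom F G"
    and gw: "\<And>w. w \<in> words X \<Longrightarrow> g (word_class X w) = eval_word G f w"
    unfolding F_def using free_group_universal[OF f] by blast
  interpret g: group_hom F G g by unfold_locales (rule g)
  have cl: "word_class X w \<in> carrier F" if "w \<in> words X" for w
    using that by (simp add: F_def carrier_free_group)
  have "relators X R \<subseteq> kernel F G g"
  proof
    fix r assume "r \<in> relators X R"
    then obtain u v where uv: "(u, v) \<in> R"
      and r: "r = word_class X u \<otimes>\<^bsub>F\<^esub> inv\<^bsub>F\<^esub> word_class X v"
      by (auto simp: relators_def F_def)
    have uvw: "u \<in> words X" "v \<in> words X" using uv R by auto
    then have "g r = eval_word G f u \<otimes> inv eval_word G f u"
      using uv cl rel by (simp add: r gw)
    then show "r \<in> kernel F G g"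
      using uvw cl f by (simp add: kernel_def r)
  qed
  then have le: "normal_closure F (relators X R) \<subseteq> kernel F G g"
    using g.normal_kernel unfolding normal_closure_def by blast
  have "normal_closure F (relators X R) \<lhd> F"
    unfolding F_def
    by (rule group.normal_closure_normal[OF group_free_group relators_closed[OF R]])
  then obtain h where h: "h \<in> hom (F Mod normal_closure F (relators X R)) G"
    and hg: "\<And>c. c \<in> carrier F \<Longrightarrow> h (normal_closure F (relators X R) #>\<^bsub>F\<^esub> c) = g c"
    using g.FactGroup_universal_kernel[OF _ le] by blast
  show thesis
  proof (rule that)
    show "h \<in> hom (presented_group X R) G"
      using h by (simp add: presented_group_def F_def)
    show "h (generator X R x) = f x" if "x \<in> X" for x
    proof -
      have "f x \<in> carrier G" using f that by auto
      then show ?thesis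
        using hg[OF cl, of "[(x, True)]"] gw[of "[(x, True)]"] that
        by (simp add: generator_def F_def)
    qed
  qed
qed

lemma presented_group_relation:
  assumes R: "R \<subseteq> words X \<times> words X"
  shows generator_closed: "generator X R \<in> X \<rightarrow> carrier (presented_group X R)"
    and "\<And>u v. (u, v) \<in> R \<Longrightarrow>
      eval_word (presented_group X R) (generator X R) u =
      eval_word (presented_group X R) (generator X R) v"
proof -
  define F where "F = free_group X"
  define N where "N = normal_closure F (relators X R)"
  define P where "P = presented_group X R"
  have P: "P = F Mod N" by (simp add: P_def presented_group_def F_def N_def)
  interpret F: group F unfolding F_def by (rule group_free_group)
  interpret P: group P unfolding P_def by (rule group_presented_group[OF R])
  have rcl: "relators X R \<subseteq> carrier F"
    unfolding F_def by (rule relators_closed[OF R])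
  interpret N: normal N F
    unfolding N_def by (rule F.normal_closure_normal[OF rcl])
  interpret q: group_hom F P "\<lambda>c. N #>\<^bsub>F\<^esub> c"
    by unfold_locales (simp add: P N.r_coset_hom_Mod)
  have cl: "word_class X w \<in> carrier F" if "w \<in> words X" for w
    using that by (simp add: F_def carrier_free_group)
  have gen: "generator X R x = N #>\<^bsub>F\<^esub> word_class X [(x, True)]" for x
    by (simp add: generator_def N_def F_def)
  show gcl: "generator X R \<in> X \<rightarrow> carrier (presented_group X R)"
    unfolding P_def[symmetric] gen using cl q.hom_closed by auto
  have letter: "N #>\<^bsub>F\<^esub> word_class X [(x, b)] =
      (if b then generator X R x else inv\<^bsub>P\<^esub> generator X R x)" if x: "x \<in> X" for x b
  proof (cases b)
    case False
    have "([(x, False), (x, \<not> False)] , []) \<in> free_rel X"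
      using free_rel.cancel[of "[]" X "[]" x False] x by simp
    then have "word_class X [(x, False)] \<otimes>\<^bsub>F\<^esub> word_class X [(x, True)] = \<one>\<^bsub>F\<^esub>"
      using x by (simp add: F_def mult_free_group one_free_group word_class_eq_iff)
    then have "word_class X [(x, False)] = inv\<^bsub>F\<^esub> word_class X [(x, True)]"
      using x cl by (intro F.inv_equality[symmetric]) simp_all
    then show ?thesis
      using False x cl by (simp add: gen)
  qed (simp add: gen)
  have ev: "eval_word P (generator X R) w = N #>\<^bsub>F\<^esub> word_class X w" if "w \<in> words X" for w
    using that
  proof (induction w)
    case Nil
    show ?case using q.hom_one by (simp add: F_def one_free_group)
  next
    case (Cons p w)
    obtain x b where p: "p = (x, b)" by force
    have "word_class X (p # w) = word_class X [p] \<otimes>\<^bsub>F\<^esub> word_class X w"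
      using Cons.prems by (simp add: F_def mult_free_group)
    then show ?case
      using Cons cl p by (simp add: letter)
  qed
  show "eval_word (presented_group X R) (generator X R) u =
      eval_word (presented_group X R) (generator X R) v" if uv: "(u, v) \<in> R" for u v
  proof -
    have uvw: "u \<in> words X" "v \<in> words X" using uv R by auto
    have "word_class X u \<otimes>\<^bsub>F\<^esub> inv\<^bsub>F\<^esub> word_class X v \<in> relators X R"
      using uv by (force simp: relators_def F_def)
    then have "word_class X u \<otimes>\<^bsub>F\<^esub> inv\<^bsub>F\<^esub> word_class X v \<in> N"
      by (auto simp: N_def normal_closure_def)
    then have "N #>\<^bsub>F\<^esub> word_class X u = N #>\<^bsub>F\<^esub> word_class X v"
      using uvw cl N.is_subgroup N.subset
      by (intro F.coset_mult_inv1 F.coset_join2) simp_all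
    then show ?thesis using ev uvw by (simp add: P_def)
  qed
qed

section \<open>The group of normal forms\<close>

text \<open>The triple \<open>(i, j, n)\<close> stands for \<open>a\<^sup>i b\<^sup>j x\<^sup>n\<close>. In a product of two such expressions, moving
  \<open>x\<^sup>n\<close> to the right inverts \<open>a\<close> and \<open>b\<close> when \<open>n\<close> is odd, and moving \<open>b\<^sup>j\<close> past \<open>a\<^sup>k\<close> costs a
  factor \<open>x\<close> to the power \<open>-4 j k\<close>, with the sign of \<open>k\<close> changed if \<open>n\<close> is odd.\<close>

definition nil_mult :: "int \<times> int \<times> int \<Rightarrow> int \<times> int \<times> int \<Rightarrow> int \<times> int \<times> int" where
  "nil_mult = (\<lambda>(i, j, n) (k, l, m).
     if even n then (i + k, j + l, n + m - 4 * j * k) else (i - k, j - l, n + m + 4 * j * k))"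

definition nil_group :: "(int \<times> int \<times> int) monoid" where
  "nil_group = \<lparr>carrier = UNIV, mult = nil_mult, one = (0, 0, 0)\<rparr>"

lemma nil_group_simps [simp]:
  "carrier nil_group = UNIV" "\<one>\<^bsub>nil_group\<^esub> = (0, 0, 0)"
  "p \<otimes>\<^bsub>nil_group\<^esub> q = nil_mult p q"
  by (simp_all add: nil_group_def)

lemma group_nil_group: "group nil_group"
proof (rule groupI)
  fix p q r assume "p \<in> carrier nil_group"
  show "p \<otimes>\<^bsub>nil_group\<^esub> q \<otimes>\<^bsub>nil_group\<^esub> r = p \<otimes>\<^bsub>nil_group\<^esub> (q \<otimes>\<^bsub>nil_group\<^esub> r)"
    by (cases p; cases q; cases r) (auto simp: nil_mult_def algebra_simps)
next
  fix p assume "p \<in> carrier nil_group"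
  obtain i j n where p: "p = (i, j, n)" by (cases p)
  show "\<exists>q\<in>carrier nil_group. q \<otimes>\<^bsub>nil_group\<^esub> p = \<one>\<^bsub>nil_group\<^esub>"
  proof (cases "even n")
    case True
    then show ?thesis
      by (intro bexI[of _ "(- i, - j, - n - 4 * j * i)"]) (simp_all add: p nil_mult_def)
  next
    case False
    then show ?thesis
      by (intro bexI[of _ "(i, j, - n - 4 * j * i)"]) (simp_all add: p nil_mult_def)
  qed
qed (auto simp: nil_mult_def)

context group
begin

lemma conj_int_pow:
  assumes "g \<in> carrier G" "h \<in> carrier G"
  shows "(g \<otimes> h \<otimes> inv g) [^] (k::int) = g \<otimes> h [^] k \<otimes> inv g"
proof -
  have "(\<lambda>h. g \<otimes> h \<otimes> inv g) \<in> hom G G"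
    using assms(1) by (auto simp: hom_def m_assoc inv_solve_left)
  then show ?thesis
    using hom_int_pow[of "\<lambda>h. g \<otimes> h \<otimes> inv g" G G h k] assms(2) group_axioms by simp
qed

lemma inverting_int_pow:
  fixes n k :: int
  assumes x: "x \<in> carrier G" and c: "c \<in> carrier G" and inverts: "x \<otimes> c \<otimes> inv x = inv c"
  shows "x [^] n \<otimes> c [^] k = c [^] (if even n then k else - k) \<otimes> x [^] n"
proof -
  have step: "x \<otimes> c [^] k = c [^] (- k) \<otimes> x" for k :: int
  proof -
    have "c [^] (- k) = x \<otimes> c [^] k \<otimes> inv x"
      using conj_int_pow[OF x c, of k] c by (simp add: inverts int_pow_inv int_pow_neg)
    then show ?thesis using x c by (simp add: m_assoc)
  qed
  have step': "inv x \<otimes> c [^] k = c [^] (- k) \<otimes> inv x" for k :: int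
  proof -
    have "x \<otimes> (c [^] (- k) \<otimes> inv x) = c [^] k"
      using step[of "- k"] x c by (simp add: m_assoc[symmetric]) (simp add: m_assoc)
    then show ?thesis using x c by (simp add: inv_solve_left')
  qed
  show ?thesis
  proof (induction n arbitrary: k rule: int_induct[where k = 0])
    case base
    then show ?case using c by simp
  next
    case (step1 n)
    have "x [^] (n + 1) \<otimes> c [^] k = (x [^] n \<otimes> c [^] (- k)) \<otimes> x"
      using x c by (simp add: int_pow_mult m_assoc step)
    then show ?case
      using x c by (simp add: step1 int_pow_mult m_assoc)
  next
    case (step2 n)
    have n: "x [^] (n - 1) = x [^] n \<otimes> inv x"
      using x by (simp add: int_pow_diff)
    have "x [^] (n - 1) \<otimes> c [^] k = (x [^] n \<otimes> c [^] (- k)) \<otimes> inv x"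
      using x c by (simp add: n m_assoc step')
    then show ?case
      using x c by (simp add: step2 n m_assoc)
  qed
qed

text \<open>The three relations suffice to collect a product of normal forms. The power \<open>x\<^sup>-\<^sup>4\<close> is even,
  so it commutes with \<open>a\<close> and \<open>b\<close>. Hence \<open>b a b\<inverse> = a x\<^sup>-\<^sup>4\<close> can be raised to the power \<open>k\<close>, and
  the resulting formula for \<open>a\<^sup>-\<^sup>k b a\<^sup>k\<close> can be raised to the power \<open>j\<close>.\<close>

lemma normal_form_hom:
  assumes x: "x \<in> carrier G" and a: "a \<in> carrier G" and b: "b \<in> carrier G"
    and xa: "x \<otimes> a \<otimes> inv x = inv a" and xb: "x \<otimes> b \<otimes> inv x = inv b"
    and ba: "b \<otimes> a = a \<otimes> b \<otimes> x [^] (-4::int)"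
  shows "(\<lambda>(i, j, n). a [^] i \<otimes> b [^] j \<otimes> x [^] n) \<in> hom nil_group G"
proof -
  define w where "w = x [^] (-4::int)"
  have w: "w \<in> carrier G" using x by (simp add: w_def)
  have w_pow: "w [^] k = x [^] (- 4 * k)" for k :: int
    using x by (simp add: w_def int_pow_pow)
  have wa: "w [^] k \<otimes> a [^] l = a [^] l \<otimes> w [^] k" 
    and wb: "w [^] k \<otimes> b [^] l = b [^] l \<otimes> w [^] k" for k l :: int
    using inverting_int_pow[OF x a xa, of "- 4 * k"] inverting_int_pow[OF x b xb, of "- 4 * k"]
    by (simp_all add: w_pow)
  have ba_pow: "b [^] j \<otimes> a [^] k = a [^] k \<otimes> b [^] j \<otimes> x [^] (- 4 * j * k)" for j k :: int
  proof -
    have "b \<otimes> a = a \<otimes> w \<otimes> b"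
      using wb[of 1 1] a b w by (simp add: ba w_def[symmetric] m_assoc)
    then have "b \<otimes> a \<otimes> inv b = a \<otimes> w"
      using a b w by (simp add: inv_solve_right')
    moreover have "(a \<otimes> w) [^] k = a [^] k \<otimes> w [^] k"
      using wa[of 1 1] a w by (intro int_pow_mult_distrib) simp_all
    ultimately have "b \<otimes> a [^] k \<otimes> inv b = a [^] k \<otimes> w [^] k"
      using conj_int_pow[OF b a, of k] by simp
    then have "b \<otimes> a [^] k = a [^] k \<otimes> w [^] k \<otimes> b"
      using a b w by (simp add: inv_solve_right')
    also have "\<dots> = a [^] k \<otimes> (b \<otimes> w [^] k)"
      using wb[of k 1] a b w by (simp add: m_assoc)
    finally have "inv (a [^] k) \<otimes> (b \<otimes> a [^] k) = b \<otimes> w [^] k"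
      using a b w by (simp add: inv_solve_left')
    then have "inv (a [^] k) \<otimes> b \<otimes> inv (inv (a [^] k)) = b \<otimes> w [^] k"
      using a b w by (simp add: m_assoc)
    then have "inv (a [^] k) \<otimes> b [^] j \<otimes> a [^] k = (b \<otimes> w [^] k) [^] j"
      using conj_int_pow[of "inv (a [^] k)" b j] a b by simp
    also have "\<dots> = b [^] j \<otimes> x [^] (- 4 * j * k)"
      using wb[of k 1] b w x
      by (subst int_pow_mult_distrib) (simp_all add: w_def int_pow_pow algebra_simps)
    finally show ?thesis
      using a b x by (simp add: m_assoc inv_solve_left')
  qed
  have "a [^] i \<otimes> b [^] j \<otimes> x [^] n \<otimes> (a [^] k \<otimes> b [^] l \<otimes> x [^] m) =
      a [^] (i + k') \<otimes> b [^] (j + l') \<otimes> x [^] (n + m - 4 * j * k')"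
    if k': "k' = (if even n then k else - k)" and l': "l' = (if even n then l else - l)"
    for i j n k l m k' l' :: int
  proof -
    have xk: "x [^] n \<otimes> a [^] k = a [^] k' \<otimes> x [^] n"
      and xl: "x [^] n \<otimes> b [^] l = b [^] l' \<otimes> x [^] n"
      unfolding k' l' by (rule inverting_int_pow[OF x a xa] inverting_int_pow[OF x b xb])+
    have xb': "x [^] (- 4 * j * k') \<otimes> b [^] l' = b [^] l' \<otimes> x [^] (- 4 * j * k')"
      using inverting_int_pow[OF x b xb, of "- 4 * j * k'" l'] by simp
    have "a [^] i \<otimes> b [^] j \<otimes> x [^] n \<otimes> (a [^] k \<otimes> b [^] l \<otimes> x [^] m) =
        a [^] i \<otimes> b [^] j \<otimes> (x [^] n \<otimes> a [^] k) \<otimes> b [^] l \<otimes> x [^] m"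
      using a b x by (simp add: m_assoc)
    also have "\<dots> = a [^] i \<otimes> b [^] j \<otimes> a [^] k' \<otimes> (x [^] n \<otimes> b [^] l) \<otimes> x [^] m"
      unfolding xk using a b x by (simp add: m_assoc)
    also have "\<dots> = a [^] i \<otimes> (b [^] j \<otimes> a [^] k') \<otimes> b [^] l' \<otimes> x [^] n \<otimes> x [^] m"
      unfolding xl using a b x by (simp add: m_assoc)
    also have "\<dots> = a [^] i \<otimes> a [^] k' \<otimes> b [^] j \<otimes> (x [^] (- 4 * j * k') \<otimes> b [^] l') \<otimes> x [^] n \<otimes> x [^] m"
      unfolding ba_pow using a b x by (simp add: m_assoc)
    also have "\<dots> = (a [^] i \<otimes> a [^] k') \<otimes> (b [^] j \<otimes> b [^] l') \<otimes> (x [^] (- 4 * j * k') \<otimes> x [^] n \<otimes> x [^] m)"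
      unfolding xb' using a b x by (simp add: m_assoc)
    also have "\<dots> = a [^] (i + k') \<otimes> b [^] (j + l') \<otimes> x [^] (- 4 * j * k' + n + m)"
      using a b x by (simp only: int_pow_mult[symmetric])
    finally show ?thesis by (simp add: algebra_simps)
  qed
  then show ?thesis
    using a b x by (auto simp: hom_def nil_mult_def)
qed

lemma inverts_quotient_of_equal_squares:
  assumes "g \<in> carrier G" "h \<in> carrier G" and sq: "g \<otimes> g = h \<otimes> h"
  shows "h \<otimes> (g \<otimes> inv h) \<otimes> inv h = inv (g \<otimes> inv h)"
proof -
  have "h \<otimes> (g \<otimes> inv h) \<otimes> inv h = h \<otimes> g \<otimes> inv (h \<otimes> h)"
    using assms by (simp add: m_assoc inv_mult_group)
  also have "\<dots> = inv (g \<otimes> inv h)"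
    unfolding sq[symmetric] using assms(1,2)
    by (simp add: m_assoc inv_mult_group) (simp add: m_assoc[symmetric])
  finally show ?thesis .
qed

text \<open>Each relation says that three cyclically consecutive generators multiply to the fourth, so
  four consecutive ones multiply to the square of the first as well as to that of the last. Thus all
  generators have the same square \<open>z\<close>, and \<open>z\<close> commutes with each of them. The relation between
  \<open>a\<close> and \<open>b\<close> comes from \<open>swap\<close>: expanding \<open>x\<^sub>4 = x\<^sub>1 x\<^sub>2 x\<^sub>3\<close> in \<open>x\<^sub>2 x\<^sub>1 x\<^sub>4\<close> makes two
  squares appear, leaving \<open>x\<^sub>3 = x\<^sub>4 x\<^sub>1 x\<^sub>2\<close>.\<close>

lemma H4_relations_imp_normal_form_relations:
  assumes cl: "x1 \<in> carrier G" "x2 \<in> carrier G" "x3 \<in> carrier G" "x4 \<in> carrier G"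
    and r4: "x1 \<otimes> x2 \<otimes> x3 = x4" and r1: "x2 \<otimes> x3 \<otimes> x4 = x1"
    and r2: "x3 \<otimes> x4 \<otimes> x1 = x2" and r3: "x4 \<otimes> x1 \<otimes> x2 = x3"
  defines "a \<equiv> x2 \<otimes> inv x1" and "b \<equiv> x4 \<otimes> inv x1"
  shows "x1 \<otimes> a \<otimes> inv x1 = inv a" and "x1 \<otimes> b \<otimes> inv x1 = inv b"
    and "b \<otimes> a = a \<otimes> b \<otimes> x1 [^] (-4::int)"
proof -
  define z where "z = x1 \<otimes> x1"
  have z: "z \<in> carrier G" using cl by (simp add: z_def)
  have sq4: "x4 \<otimes> x4 = z"
  proof -
    have "x1 \<otimes> x2 \<otimes> x3 \<otimes> x4 = x1 \<otimes> (x2 \<otimes> x3 \<otimes> x4)"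
      using cl by (simp add: m_assoc)
    then show ?thesis by (simp add: r1 r4 z_def)
  qed
  have sq2: "x2 \<otimes> x2 = z"
  proof -
    have "x2 \<otimes> (x3 \<otimes> x4 \<otimes> x1) = x2 \<otimes> x3 \<otimes> x4 \<otimes> x1"
      using cl by (simp add: m_assoc)
    then show ?thesis by (simp add: r1 r2 z_def)
  qed
  show "x1 \<otimes> a \<otimes> inv x1 = inv a" "x1 \<otimes> b \<otimes> inv x1 = inv b"
    unfolding a_def b_def
    by (rule inverts_quotient_of_equal_squares; use cl sq2 sq4 z_def in simp)+
  have sq3: "x3 \<otimes> x3 = z"
  proof -
    have "x3 \<otimes> (x4 \<otimes> x1 \<otimes> x2) = x3 \<otimes> x4 \<otimes> x1 \<otimes> x2"
      using cl by (simp add: m_assoc)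
    then show ?thesis by (simp add: r2 r3 sq2)
  qed
  have central: "z \<otimes> c = c \<otimes> z" "z \<otimes> (c \<otimes> d) = c \<otimes> (z \<otimes> d)"
    if "c \<in> {x1, x2, x3, x4}" "d \<in> carrier G" for c d
  proof -
    have c: "c \<in> carrier G" "c \<otimes> c = z"
      using that cl sq2 sq3 sq4 by (auto simp: z_def)
    then show zc: "z \<otimes> c = c \<otimes> z"
      using m_assoc[of c c c] by simp
    show "z \<otimes> (c \<otimes> d) = c \<otimes> (z \<otimes> d)"
      using c z that(2) by (simp add: m_assoc[symmetric] zc)
  qed
  have swap: "x2 \<otimes> x1 \<otimes> x4 = x4 \<otimes> x1 \<otimes> x2 \<otimes> z \<otimes> z"
  proof -
    have "x2 \<otimes> x1 \<otimes> (x1 \<otimes> x2 \<otimes> x3) = x2 \<otimes> (z \<otimes> (x2 \<otimes> x3))"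
      using cl by (simp add: z_def m_assoc)
    also have "\<dots> = x2 \<otimes> x2 \<otimes> x3 \<otimes> z"
      using cl z by (simp add: central m_assoc)
    also have "\<dots> = x3 \<otimes> z \<otimes> z"
      using cl z by (simp add: sq2 central)
    finally show ?thesis by (simp add: r3 r4)
  qed
  define y where "y = inv z"
  have y: "y \<in> carrier G" using z by (simp add: y_def)
  have inv_x1: "inv x1 = x1 \<otimes> y"
    using cl z by (intro inv_equality) (simp_all add: y_def z_def inv_mult_group m_assoc)
  have y_central: "y \<otimes> c = c \<otimes> y" "y \<otimes> (c \<otimes> d) = c \<otimes> (y \<otimes> d)"
    if "c \<in> {x1, x2, x3, x4}" "d \<in> carrier G" for c d
  proof -
    have c: "c \<in> carrier G" using that cl by auto
    show yc: "y \<otimes> c = c \<otimes> y"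
    proof -
      have "z \<otimes> (c \<otimes> y) = c"
        using central[OF that(1) y] c y z by (simp add: y_def)
      then show ?thesis
        using c y z by (simp add: y_def inv_solve_left')
    qed
    show "y \<otimes> (c \<otimes> d) = c \<otimes> (y \<otimes> d)"
      using c y that(2) by (simp add: m_assoc[symmetric] yc)
  qed
  have "a \<otimes> b = (x2 \<otimes> x1 \<otimes> x4) \<otimes> x1 \<otimes> y \<otimes> y"
    using cl y by (simp add: a_def b_def inv_x1 y_central m_assoc)
  also have "\<dots> = x4 \<otimes> x1 \<otimes> x2 \<otimes> x1 \<otimes> (z \<otimes> z \<otimes> y \<otimes> y)"
    unfolding swap using cl y z by (simp add: central m_assoc)
  also have "\<dots> = x4 \<otimes> x1 \<otimes> x2 \<otimes> x1"
    using cl z by (simp add: y_def m_assoc inv_solve_left)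
  finally have ab: "a \<otimes> b = x4 \<otimes> x1 \<otimes> x2 \<otimes> x1" .
  have "x1 [^] (-4::int) = y \<otimes> y"
  proof -
    have "x1 [^] (4::int) = z \<otimes> z"
      using cl by (simp add: z_def m_assoc numeral_eq_Suc int_pow_def2 nat_pow_Suc)
    then show ?thesis
      using cl z by (simp add: y_def int_pow_neg inv_mult_group)
  qed
  then show "b \<otimes> a = a \<otimes> b \<otimes> x1 [^] (-4::int)"
    unfolding ab using cl y by (simp add: a_def b_def inv_x1 y_central m_assoc)
qed

end

section \<open>Sets without unique products\<close>

context group
begin

text \<open>Every product from \<open>(T \<union> T x) (L \<union> x L)\<close> has one of the forms \<open>t l\<close>, \<open>t x l\<close> and
  \<open>t x\<^sup>2 l\<close>, and the middle form arises both as \<open>t (x l)\<close> and as \<open>(t x) l\<close>. Since \<open>T\<close> and \<open>T x\<close>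
  are disjoint, these two factorisations differ in their first factor. So only the outer two forms
  need a second factorisation, and in \<open>lower\<close> and \<open>upper\<close> it may be of any of the three forms,
  the middle one offering two choices of first factor.\<close>

lemma doubled_sets_without_unique_product:
  assumes x: "x \<in> carrier G"
    and T: "finite T" "T \<noteq> {}" "T \<subseteq> carrier G" and L: "finite L" "L \<noteq> {}" "L \<subseteq> carrier G"
    and disj: "\<And>t. t \<in> T \<Longrightarrow> t \<otimes> x \<notin> T"
    and lower: "\<And>t l. t \<in> T \<Longrightarrow> l \<in> L \<Longrightarrow> \<exists>t'\<in>T. \<exists>l'\<in>L. t' \<noteq> t \<and> t' \<otimes> l' = t \<otimes> l \<or>
      t' \<otimes> x \<otimes> l' = t \<otimes> l \<or> t' \<otimes> x \<otimes> (x \<otimes> l') = t \<otimes> l"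
    and upper: "\<And>t l. t \<in> T \<Longrightarrow> l \<in> L \<Longrightarrow> \<exists>t'\<in>T. \<exists>l'\<in>L.
      t' \<noteq> t \<and> t' \<otimes> x \<otimes> (x \<otimes> l') = t \<otimes> x \<otimes> (x \<otimes> l) \<or>
      t' \<otimes> x \<otimes> l' = t \<otimes> x \<otimes> (x \<otimes> l) \<or> t' \<otimes> l' = t \<otimes> x \<otimes> (x \<otimes> l)"
  shows "\<not> unique_product_property G"
proof
  define A where "A = T \<union> (\<lambda>t. t \<otimes> x) ` T"
  define B where "B = L \<union> (\<lambda>l. x \<otimes> l) ` L"
  assume "unique_product_property G"
  then have upp: "\<exists>p\<in>A. \<exists>q\<in>B. \<forall>p'\<in>A. \<forall>q'\<in>B.
      p \<otimes> q = p' \<otimes> q' \<longrightarrow> p = p' \<and> q = q'"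
    if "finite A \<and> A \<noteq> {} \<and> A \<subseteq> carrier G \<and> finite B \<and> B \<noteq> {} \<and> B \<subseteq> carrier G"
    using that unfolding unique_product_property_def by (elim allE[of _ A] allE[of _ B]) simp
  have "finite A \<and> A \<noteq> {} \<and> A \<subseteq> carrier G \<and> finite B \<and> B \<noteq> {} \<and> B \<subseteq> carrier G"
    using T L x by (auto simp: A_def B_def)
  from upp[OF this] obtain p q where p: "p \<in> A" and q: "q \<in> B"
    and unique: "\<And>p' q'. p' \<in> A \<Longrightarrow> q' \<in> B \<Longrightarrow> p' \<otimes> q' = p \<otimes> q \<Longrightarrow> p' = p"
    by metis
  have in_A: "t \<in> A" "t \<otimes> x \<in> A" if "t \<in> T" for t
    using that by (auto simp: A_def)
  have in_B: "l \<in> B" "x \<otimes> l \<in> B" if "l \<in> L" for l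
    using that by (auto simp: B_def)
  have cl: "t \<in> carrier G" if "t \<in> T \<or> t \<in> L" for t
    using that T L by auto
  have disj': "t' \<otimes> x \<noteq> t" if "t' \<in> T" "t \<in> T" for t' t
    using disj that by blast
  obtain t l where t: "t \<in> T" and l: "l \<in> L" and pq: "p = t \<or> p = t \<otimes> x" "q = l \<or> q = x \<otimes> l"
    using p q by (auto simp: A_def B_def)
  have shift: "t \<otimes> x \<otimes> l = t \<otimes> (x \<otimes> l)" if "t \<in> T" "l \<in> L" for t l
    using that cl x by (simp add: m_assoc)
  consider "p = t" "q = x \<otimes> l" | "p = t \<otimes> x" "q = l" | "p = t" "q = l" | "p = t \<otimes> x" "q = x \<otimes> l"
    using pq by blast
  then show False
  proof cases
    case 1
    then show False
      using unique[of "t \<otimes> x" l] t l in_A in_B shift disj' by auto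
  next
    case 2
    then show False
      using unique[of t "x \<otimes> l"] t l in_A in_B shift disj'[of t t] by auto
  next
    case 3
    from lower[OF t l] obtain t' l' where t'l': "t' \<in> T" "l' \<in> L" and "t' \<noteq> t \<and> t' \<otimes> l' = t \<otimes> l \<or>
      t' \<otimes> x \<otimes> l' = t \<otimes> l \<or> t' \<otimes> x \<otimes> (x \<otimes> l') = t \<otimes> l"
      by blast
    then show False
      using unique[of t' l'] unique[of "t' \<otimes> x" l'] unique[of "t' \<otimes> x" "x \<otimes> l'"]
        in_A in_B 3 t disj'[of t' t] by auto
  next
    case 4
    from upper[OF t l] obtain t' l' where t'l': "t' \<in> T" "l' \<in> L" and
      "t' \<noteq> t \<and> t' \<otimes> x \<otimes> (x \<otimes> l') = t \<otimes> x \<otimes> (x \<otimes> l) \<or>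
      t' \<otimes> x \<otimes> l' = t \<otimes> x \<otimes> (x \<otimes> l) \<or> t' \<otimes> l' = t \<otimes> x \<otimes> (x \<otimes> l)"
      by blast
    moreover have "t' \<otimes> x = t \<otimes> x \<longleftrightarrow> t' = t"
      using t t'l' cl x by simp
    ultimately show False
      using unique[of "t' \<otimes> x" "x \<otimes> l'"] unique[of t' "x \<otimes> l'"] unique[of t' l']
        in_A in_B 4 t disj'[of t t'] shift by auto
  qed
qed

lemma unique_product_property_inj_hom:
  assumes H: "group H" and h: "h \<in> hom G H" and inj: "inj_on h (carrier G)"
    and upp: "unique_product_property H"
  shows "unique_product_property G"
  unfolding unique_product_property_def
proof (intro allI impI)
  fix A B :: "'a set"
  assume AB: "finite A \<and> A \<noteq> {} \<and> A \<subseteq> carrier G \<and> finite B \<and> B \<noteq> {} \<and> B \<subseteq> carrier G"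
  then have "finite (h ` A) \<and> h ` A \<noteq> {} \<and> h ` A \<subseteq> carrier H \<and>
      finite (h ` B) \<and> h ` B \<noteq> {} \<and> h ` B \<subseteq> carrier H"
    using h by (auto simp: hom_def)
  with upp have "\<exists>p\<in>h ` A. \<exists>q\<in>h ` B. \<forall>p'\<in>h ` A. \<forall>q'\<in>h ` B.
      p \<otimes>\<^bsub>H\<^esub> q = p' \<otimes>\<^bsub>H\<^esub> q' \<longrightarrow> p = p' \<and> q = q'"
    unfolding unique_product_property_def by (elim allE[of _ "h ` A"] allE[of _ "h ` B"]) simp
  then obtain a b where ab: "a \<in> A" "b \<in> B"
    and unique: "\<And>a' b'. a' \<in> A \<Longrightarrow> b' \<in> B \<Longrightarrow> h a \<otimes>\<^bsub>H\<^esub> h b = h a' \<otimes>\<^bsub>H\<^esub> h b' \<Longrightarrow>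
      h a = h a' \<and> h b = h b'"
    by auto
  have "a = a' \<and> b = b'" if "a' \<in> A" "b' \<in> B" "a \<otimes> b = a' \<otimes> b'" for a' b'
  proof -
    have carr: "a \<in> carrier G" "b \<in> carrier G" "a' \<in> carrier G" "b' \<in> carrier G"
      using AB ab that by auto
    then have "h a \<otimes>\<^bsub>H\<^esub> h b = h a' \<otimes>\<^bsub>H\<^esub> h b'"
      using that(3) hom_mult[OF h] by metis
    then show ?thesis
      using unique[OF that(1,2)] carr inj by (auto dest: inj_onD)
  qed
  then show "\<exists>a\<in>A. \<exists>b\<in>B. \<forall>a'\<in>A. \<forall>b'\<in>B. a \<otimes> b = a' \<otimes> b' \<longrightarrow> a = a' \<and> b = b'"
    using ab by blast
qed

end

text \<open>The two sets come from a computer search over small triples, in which the identity was required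
  to lie in both. Here \<open>T\<close> consists of \<open>1\<close>, the element \<open>b x\<^sup>2\<close> and its inverse, \<open>a b\<inverse> x\<close>, and
  \<open>a b x\<inverse>\<close>, which is \<open>x\<^sub>3\<close>.\<close>

definition nil_T :: "(int \<times> int \<times> int) set" where
  "nil_T = {(0, -1, -2), (0, 0, 0), (0, 1, 2), (1, -1, 1), (1, 1, -1)}"

definition nil_L :: "(int \<times> int \<times> int) set" where
  "nil_L = {(0, -1, -1), (0, -1, 0), (0, 0, 0), (0, 0, 2), (0, 1, 2), (0, 1, 3),
    (1, -1, 1), (1, -1, 2), (1, 0, 1), (1, 1, 0), (1, 1, 1)}"

lemma nil_lower_products_repeated:
  "\<forall>t\<in>nil_T. \<forall>l\<in>nil_L. \<exists>t'\<in>nil_T. \<exists>l'\<in>nil_L.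
    t' \<noteq> t \<and> nil_mult t' l' = nil_mult t l \<or>
    nil_mult (nil_mult t' (0, 0, 1)) l' = nil_mult t l \<or>
    nil_mult (nil_mult t' (0, 0, 1)) (nil_mult (0, 0, 1) l') = nil_mult t l"
  by code_simp

lemma nil_upper_products_repeated:
  "\<forall>t\<in>nil_T. \<forall>l\<in>nil_L. \<exists>t'\<in>nil_T. \<exists>l'\<in>nil_L.
    t' \<noteq> t \<and> nil_mult (nil_mult t' (0, 0, 1)) (nil_mult (0, 0, 1) l') =
      nil_mult (nil_mult t (0, 0, 1)) (nil_mult (0, 0, 1) l) \<or>
    nil_mult (nil_mult t' (0, 0, 1)) l' = nil_mult (nil_mult t (0, 0, 1)) (nil_mult (0, 0, 1) l) \<or>
    nil_mult t' l' = nil_mult (nil_mult t (0, 0, 1)) (nil_mult (0, 0, 1) l)"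
  by code_simp

lemma not_unique_product_property_nil_group: "\<not> unique_product_property nil_group"
proof (rule group.doubled_sets_without_unique_product[OF group_nil_group,
      where x = "(0, 0, 1)" and T = nil_T and L = nil_L])
  show "t \<otimes>\<^bsub>nil_group\<^esub> (0, 0, 1) \<notin> nil_T" if "t \<in> nil_T" for t
    using that by (auto simp: nil_T_def nil_mult_def)
qed (use nil_lower_products_repeated nil_upper_products_repeated in \<open>simp_all\<close>, simp_all add: nil_T_def nil_L_def)

section \<open>Triples inside \<open>H\<^sub>4\<close>\<close>

lemma nil_group_int_pow:
  "(1, 0, 0) [^]\<^bsub>nil_group\<^esub> k = (k, 0, 0)"
  "(0, 1, 0) [^]\<^bsub>nil_group\<^esub> k = (0, k, 0)"
  "(0, 0, 1) [^]\<^bsub>nil_group\<^esub> k = (0, 0, k)" for k :: int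
proof -
  interpret group nil_group by (rule group_nil_group)
  have emb: "p [^]\<^bsub>nil_group\<^esub> k = f k"
    if f: "\<And>i j. f (i + j) = nil_mult (f i) (f j)" "f 0 = (0, 0, 0)" "f 1 = p"
    for p and f :: "int \<Rightarrow> int \<times> int \<times> int"
  proof (induction k rule: int_induct[where k = 0])
    case base then show ?case by (simp add: f)
  next
    case (step1 i)
    then show ?case by (simp add: int_pow_mult f)
  next
    case (step2 i)
    have "f (i - 1) \<otimes>\<^bsub>nil_group\<^esub> p = f i"
      using f(1)[of "i - 1" 1] f(3) by simp
    then have "f (i - 1) = f i \<otimes>\<^bsub>nil_group\<^esub> inv\<^bsub>nil_group\<^esub> p"
      by (intro inv_solve_right[THEN iffD2]) simp_all
    then show ?case
      using step2 by (simp add: int_pow_diff)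
  qed
  show "(1, 0, 0) [^]\<^bsub>nil_group\<^esub> k = (k, 0, 0)"
    "(0, 1, 0) [^]\<^bsub>nil_group\<^esub> k = (0, k, 0)"
    "(0, 0, 1) [^]\<^bsub>nil_group\<^esub> k = (0, 0, k)"
    by (rule emb; simp add: nil_mult_def)+
qed

lemma H4_relations_words: "H4_relations \<subseteq> words {1, 2, 3, 4} \<times> words {1, 2, 3, 4}"
  by (auto simp: H4_relations_def Let_def)

definition H4_gen :: "nat \<Rightarrow> nat word set set" where
  "H4_gen = generator {1, 2, 3, 4} H4_relations"

lemma H4_gen_relations:
  shows "i \<in> {1, 2, 3, 4} \<Longrightarrow> H4_gen i \<in> carrier H4"
    and "H4_gen 1 \<otimes>\<^bsub>H4\<^esub> H4_gen 2 \<otimes>\<^bsub>H4\<^esub> H4_gen 3 = H4_gen 4"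
    and "H4_gen 2 \<otimes>\<^bsub>H4\<^esub> H4_gen 3 \<otimes>\<^bsub>H4\<^esub> H4_gen 4 = H4_gen 1"
    and "H4_gen 3 \<otimes>\<^bsub>H4\<^esub> H4_gen 4 \<otimes>\<^bsub>H4\<^esub> H4_gen 1 = H4_gen 2"
    and "H4_gen 4 \<otimes>\<^bsub>H4\<^esub> H4_gen 1 \<otimes>\<^bsub>H4\<^esub> H4_gen 2 = H4_gen 3"
proof -
  interpret group H4 by (rule group_H4)
  show cl: "H4_gen i \<in> carrier H4" if "i \<in> {1, 2, 3, 4}" for i
    using generator_closed[OF H4_relations_words] that by (auto simp: H4_gen_def H4_def)
  have "\<forall>(u, v)\<in>H4_relations. eval_word H4 H4_gen u = eval_word H4 H4_gen v"
    using presented_group_relation(2)[OF H4_relations_words] by (auto simp: H4_gen_def H4_def)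
  then show "H4_gen 1 \<otimes>\<^bsub>H4\<^esub> H4_gen 2 \<otimes>\<^bsub>H4\<^esub> H4_gen 3 = H4_gen 4"
    "H4_gen 2 \<otimes>\<^bsub>H4\<^esub> H4_gen 3 \<otimes>\<^bsub>H4\<^esub> H4_gen 4 = H4_gen 1"
    "H4_gen 3 \<otimes>\<^bsub>H4\<^esub> H4_gen 4 \<otimes>\<^bsub>H4\<^esub> H4_gen 1 = H4_gen 2"
    "H4_gen 4 \<otimes>\<^bsub>H4\<^esub> H4_gen 1 \<otimes>\<^bsub>H4\<^esub> H4_gen 2 = H4_gen 3"
    using cl by (simp_all add: H4_relations_def Let_def m_assoc)
qed

text \<open>Normal forms are kept apart by the homomorphism back to triples which sends each generator to
  its own normal form; it recovers the exponents.\<close>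

lemma nil_group_embeds_in_H4:
  obtains f where "f \<in> hom nil_group H4" and "inj f"
proof -
  interpret N: group nil_group by (rule group_nil_group)
  interpret H: group H4 by (rule group_H4)
  \<comment> \<open>The normal forms of the generators: \<open>x\<^sub>1 = x\<close>, \<open>x\<^sub>2 = a x\<close>, \<open>x\<^sub>4 = b x\<close>, and
    \<open>x\<^sub>3 = x\<^sub>2\<inverse> x\<^sub>1\<inverse> x\<^sub>4 = a b x\<inverse>\<close>.\<close>
  define y :: "nat \<Rightarrow> int \<times> int \<times> int" where
    "y = (\<lambda>i. (0, 0, 0))(1 := (0, 0, 1), 2 := (1, 0, 1), 3 := (1, 1, -1), 4 := (0, 1, 1))"
  have "eval_word nil_group y u = eval_word nil_group y v" if "(u, v) \<in> H4_relations" for u v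
    using that by (auto simp: H4_relations_def Let_def y_def nil_mult_def)
  then obtain g where g: "g \<in> hom H4 nil_group"
    and gy: "\<And>i. i \<in> {1, 2, 3, 4} \<Longrightarrow> g (H4_gen i) = y i"
    using N.presented_group_universal[OF H4_relations_words, of y]
    unfolding H4_def H4_gen_def by auto
  interpret g: group_hom H4 nil_group g by unfold_locales (rule g)
  define a b x where "a = H4_gen 2 \<otimes>\<^bsub>H4\<^esub> inv\<^bsub>H4\<^esub> H4_gen 1"
    and "b = H4_gen 4 \<otimes>\<^bsub>H4\<^esub> inv\<^bsub>H4\<^esub> H4_gen 1" and "x = H4_gen 1"
  define f where "f = (\<lambda>(i, j, n).
    a [^]\<^bsub>H4\<^esub> (i::int) \<otimes>\<^bsub>H4\<^esub> b [^]\<^bsub>H4\<^esub> (j::int) \<otimes>\<^bsub>H4\<^esub> x [^]\<^bsub>H4\<^esub> (n::int))"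
  have cl: "H4_gen i \<in> carrier H4" if "i \<in> {1, 2, 3, 4}" for i
    using H4_gen_relations(1) that .
  then have abx: "a \<in> carrier H4" "b \<in> carrier H4" "x \<in> carrier H4"
    by (simp_all add: a_def b_def x_def)
  have "f \<in> hom nil_group H4"
    unfolding f_def
    using H.normal_form_hom[OF abx(3,1,2)] H4_gen_relations(2-5) cl
      H.H4_relations_imp_normal_form_relations[of "H4_gen 1" "H4_gen 2" "H4_gen 3" "H4_gen 4"]
    by (simp add: a_def b_def x_def)
  moreover have "inj f"
  proof (rule inj_on_inverseI)
    fix p
    have inv1: "inv\<^bsub>nil_group\<^esub> (0, 0, 1) = (0, 0, -1)"
      by (rule N.inv_equality) (simp_all add: nil_mult_def)
    have "g a = (1, 0, 0)" "g b = (0, 1, 0)" "g x = (0, 0, 1)"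
      using cl gy by (simp_all add: a_def b_def x_def inv1 y_def nil_mult_def)
    then show "g (f p) = p"
      using abx by (cases p) (simp add: f_def g.hom_int_pow nil_group_int_pow nil_mult_def)
  qed
  ultimately show thesis by (rule that)
qed

theorem proposition7p1:
  shows "\<not> unique_product_property H4"
proof -
  obtain f where "f \<in> hom nil_group H4" "inj f"
    by (rule nil_group_embeds_in_H4)
  then show ?thesis
    using group.unique_product_property_inj_hom[OF group_nil_group group_H4]
      not_unique_product_property_nil_group by (auto simp: inj_on_def)
qed

end
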